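(* Let $-\infty<a<b<\infty$. The primitive sequence map $S$ is affine on $\mathcal{P}_{[a,b]}$, and it is continuous when $\mathcal{P}_{[a,b]}$ is equipped with the weak topology and $\prod_{n=0}^\infty[0,(b-a)^n/n!]$ is equipped with the product topology. In particular, if $\mu_k,\mu\in\mathcal{P}_{[a,b]}$ and $\mu_k$ converges weakly to $\mu$ as $k\to\infty$, then $\varepsilon_n(\mu_k)\to\varepsilon_n(\mu)$ for every $n\ge0$.
   Context: $\mathcal{P}_{[a,b]}$ denotes the set of Borel probability measures on $[a,b]$. For $\mu\in\mathcal{P}_{[a,b]}$ and $n\ge0$ let $\varepsilon_n(\mu):=\frac1{n!}\int_{[a,b]}(b-x)^n\,\mu(dx)$ (with $0^0=1$). The primitive sequence map is $S:\mathcal{P}_{[a,b]}\to\prod_{n=0}^\infty\left[0,(b-a)^n/n!\right]$, $S(\mu)=\{\varepsilon_n(\mu)\}_{n\ge0}$. Affine means $S(\lambda\mu_1+(1-\lambda)\mu_2)=\lambda S(\mu_1)+(1-\lambda)S(\mu_2)$ for all $\mu_1,\mu_2\in\mathcal{P}_{[a,b]}$ and $\lambda\in[0,1]$. *)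

theory Defs
  imports "HOL-Probability.Probability"
begin

definition borel_probs :: "real \<Rightarrow> real \<Rightarrow> real measure set" where
  "borel_probs a b = {\<mu>. prob_space \<mu> \<and> sets \<mu> = sets (restrict_space borel {a..b})}"

lemma space_borel_probs: "\<mu> \<in> borel_probs a b \<Longrightarrow> space \<mu> = {a..b}"
  by (auto simp: borel_probs_def space_restrict_space dest: sets_eq_imp_space_eq)

text \<open>The measure \<open>c \<mu> + (1 - c) \<nu>\<close>, for \<open>c\<close> in the unit interval and measures with the
  same measurable sets.\<close>

definition mixture :: "real \<Rightarrow> 'a measure \<Rightarrow> 'a measure \<Rightarrow> 'a measure" where
  "mixture c \<mu> \<nu> = measure_of (space \<mu>) (sets \<mu>)
     (\<lambda>A. ennreal c * emeasure \<mu> A + ennreal (1 - c) * emeasure \<nu> A)"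

lemma space_mixture [simp]: "space (mixture c \<mu> \<nu>) = space \<mu>"
  and sets_mixture [simp]: "sets (mixture c \<mu> \<nu>) = sets \<mu>"
  by (simp_all add: mixture_def)

lemma emeasure_mixture:
  assumes "sets \<nu> = sets \<mu>" and A: "A \<in> sets \<mu>"
  shows "emeasure (mixture c \<mu> \<nu>) A = ennreal c * emeasure \<mu> A + ennreal (1 - c) * emeasure \<nu> A"
  unfolding mixture_def
proof (rule emeasure_measure_of_sigma)
  show "sigma_algebra (space \<mu>) (sets \<mu>)" ..
  show "positive (sets \<mu>) (\<lambda>A. ennreal c * emeasure \<mu> A + ennreal (1 - c) * emeasure \<nu> A)"
    by (simp add: positive_def)
  show "countably_additive (sets \<mu>) (\<lambda>A. ennreal c * emeasure \<mu> A + ennreal (1 - c) * emeasure \<nu> A)"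
  proof (rule countably_additiveI)
    fix B :: "nat \<Rightarrow> 'a set"
    assume B: "range B \<subseteq> sets \<mu>" "disjoint_family B"
    then have "(\<Sum>i. emeasure \<mu> (B i)) = emeasure \<mu> (\<Union>i. B i)"
        "(\<Sum>i. emeasure \<nu> (B i)) = emeasure \<nu> (\<Union>i. B i)"
      using assms(1) by (auto intro!: suminf_emeasure)
    then show "(\<Sum>i. ennreal c * emeasure \<mu> (B i) + ennreal (1 - c) * emeasure \<nu> (B i)) =
        ennreal c * emeasure \<mu> (\<Union>i. B i) + ennreal (1 - c) * emeasure \<nu> (\<Union>i. B i)"
      by (simp add: suminf_add [symmetric])
  qed
qed (fact A)

lemma mixture_in_borel_probs:
  assumes "\<mu> \<in> borel_probs a b" "\<nu> \<in> borel_probs a b" "c \<in> {0..1}"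
  shows "mixture c \<mu> \<nu> \<in> borel_probs a b"
proof -
  have eq: "sets \<nu> = sets \<mu>" and sp: "space \<nu> = space \<mu>"
    using assms by (auto simp: borel_probs_def space_borel_probs)
  have "emeasure \<mu> (space \<mu>) = 1" "emeasure \<nu> (space \<mu>) = 1"
    using assms sp by (auto simp: borel_probs_def dest: prob_space.emeasure_space_1)
  then have "emeasure (mixture c \<mu> \<nu>) (space \<mu>) = 1"
    using assms(3) eq by (simp add: emeasure_mixture flip: ennreal_plus)
  then show ?thesis
    using assms(1) by (auto simp: borel_probs_def intro: prob_spaceI)
qed

text \<open>The coarsest topology on \<open>borel_probs a b\<close> making \<open>\<mu> \<mapsto> \<integral> f d\<mu>\<close> continuous for every
  continuous \<open>f\<close> on the compact interval (such \<open>f\<close> are automatically bounded).\<close>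

definition weak_topology :: "real \<Rightarrow> real \<Rightarrow> real measure topology" where
  "weak_topology a b = topology_generated_by
     {{\<mu> \<in> borel_probs a b. (\<integral>x. f x \<partial>\<mu>) \<in> U} | (f :: real \<Rightarrow> real) U.
        continuous_on {a..b} f \<and> open U}"

definition weakly_converges ::
    "real \<Rightarrow> real \<Rightarrow> (nat \<Rightarrow> real measure) \<Rightarrow> real measure \<Rightarrow> bool" where
  "weakly_converges a b \<mu>s \<mu> \<longleftrightarrow> (\<forall>f :: real \<Rightarrow> real. continuous_on {a..b} f \<longrightarrow>
     (\<lambda>k. \<integral>x. f x \<partial>\<mu>s k) \<longlonglongrightarrow> (\<integral>x. f x \<partial>\<mu>))"

lemma topspace_weak_topology [simp]: "topspace (weak_topology a b) = borel_probs a b"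
proof
  show "topspace (weak_topology a b) \<subseteq> borel_probs a b"
    unfolding weak_topology_def topology_generated_by_topspace by blast
  have "borel_probs a b = {\<mu> \<in> borel_probs a b. (\<integral>x. 0 \<partial>\<mu>) \<in> (UNIV :: real set)}"
    by simp
  moreover have "continuous_on {a..b} (\<lambda>_. 0 :: real)" "open (UNIV :: real set)"
    by simp_all
  ultimately show "borel_probs a b \<subseteq> topspace (weak_topology a b)"
    unfolding weak_topology_def topology_generated_by_topspace by blast
qed

lemma limitin_weak_topology_iff:
  assumes "\<And>k. \<mu>s k \<in> borel_probs a b" "\<mu> \<in> borel_probs a b"
  shows "limitin (weak_topology a b) \<mu>s \<mu> sequentially \<longleftrightarrow> weakly_converges a b \<mu>s \<mu>"
proof
  assume lim: "limitin (weak_topology a b) \<mu>s \<mu> sequentially"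
  show "weakly_converges a b \<mu>s \<mu>"
    unfolding weakly_converges_def
  proof (intro allI impI topological_tendstoI)
    fix f :: "real \<Rightarrow> real" and U
    assume f: "continuous_on {a..b} f" and U: "open U" "(\<integral>x. f x \<partial>\<mu>) \<in> U"
    have "openin (weak_topology a b) {\<mu> \<in> borel_probs a b. (\<integral>x. f x \<partial>\<mu>) \<in> U}"
      unfolding weak_topology_def using f U by (intro topology_generated_by_Basis) blast
    then have "\<forall>\<^sub>F k in sequentially. \<mu>s k \<in> {\<mu> \<in> borel_probs a b. (\<integral>x. f x \<partial>\<mu>) \<in> U}"
      using lim U assms(2) unfolding limitin_def by blast
    then show "\<forall>\<^sub>F k in sequentially. (\<integral>x. f x \<partial>\<mu>s k) \<in> U"
      by (rule eventually_mono) simp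
  qed
next
  assume w: "weakly_converges a b \<mu>s \<mu>"
  have "\<forall>\<^sub>F k in sequentially. \<mu>s k \<in> V"
    if "openin (weak_topology a b) V" "\<mu> \<in> V" for V
  proof -
    from that(1) have "generate_topology_on {{\<mu> \<in> borel_probs a b. (\<integral>x. f x \<partial>\<mu>) \<in> U} |
        (f :: real \<Rightarrow> real) U. continuous_on {a..b} f \<and> open U} V"
      unfolding weak_topology_def by (rule openin_topology_generated_by)
    then show ?thesis using that(2)
    proof induction
      case Empty
      then show ?case by simp
    next
      case (Int A B)
      then show ?case by (auto intro: eventually_conj)
    next
      case (UN K)
      then obtain A where "A \<in> K" "\<mu> \<in> A" by blast
      from UN.IH[OF this] show ?case
        by (rule eventually_mono) (use \<open>A \<in> K\<close> in blast)
    next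
      case (Basis A)
      then obtain f :: "real \<Rightarrow> real" and U
        where A: "A = {\<mu> \<in> borel_probs a b. (\<integral>x. f x \<partial>\<mu>) \<in> U}"
          and f: "continuous_on {a..b} f" and U: "open U" by blast
      have "(\<lambda>k. \<integral>x. f x \<partial>\<mu>s k) \<longlonglongrightarrow> (\<integral>x. f x \<partial>\<mu>)"
        using w f by (simp add: weakly_converges_def)
      then have "\<forall>\<^sub>F k in sequentially. (\<integral>x. f x \<partial>\<mu>s k) \<in> U"
        using U Basis A by (intro topological_tendstoD) auto
      then show ?case
        by (rule eventually_mono) (simp add: A assms(1))
    qed
  qed
  then show "limitin (weak_topology a b) \<mu>s \<mu> sequentially"
    using assms(2) by (simp add: limitin_def)
qed

text \<open>The integral ranges over \<open>space \<mu> = {a..b}\<close>, so \<open>a\<close> does not appear; \<open>0 ^ 0 = 1\<close> in HOL.\<close>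

definition eps :: "real \<Rightarrow> nat \<Rightarrow> real measure \<Rightarrow> real" where
  "eps b n \<mu> = 1 / fact n * (\<integral>x. (b - x) ^ n \<partial>\<mu>)"

definition primitive_seq :: "real \<Rightarrow> real measure \<Rightarrow> nat \<Rightarrow> real" where
  "primitive_seq b \<mu> = (\<lambda>n. eps b n \<mu>)"

end

theory Submission
  imports Defs
begin

text \<open>Up to the factor 1/n!, each coordinate of S is the integral of the fixed function (b -
  x)^n, which is continuous on [a,b]. Integrating a fixed integrable function is affine in the
  measure (\<open>integral_mixture\<close>), and integrating a continuous function is weakly
  continuous by the very choice of the topology
  (\<open>continuous_map_weak_topology_integral\<close>). A map into a product is continuous iff its
  coordinates are, and \<open>eps_bounds\<close> places each coordinate in its interval.\<close>

lemma nn_integral_mixture: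
  assumes [measurable_cong]: "sets \<nu> = sets \<mu>" and "f \<in> borel_measurable \<mu>"
  shows "(\<integral>\<^sup>+x. f x \<partial>mixture c \<mu> \<nu>) =
    ennreal c * (\<integral>\<^sup>+x. f x \<partial>\<mu>) + ennreal (1 - c) * (\<integral>\<^sup>+x. f x \<partial>\<nu>)"
proof -
  note sets_mixture [of c \<mu> \<nu>, measurable_cong]
  show ?thesis
    using assms(2)
  proof (induction rule: borel_measurable_induct)
    case (cong f g)
    then have "(\<integral>\<^sup>+x. f x \<partial>M) = (\<integral>\<^sup>+x. g x \<partial>M)" if "space M = space \<mu>" for M
      using that by (intro nn_integral_cong) simp
    with cong.IH show ?case
      using sets_eq_imp_space_eq [OF assms(1)] by simp
  next
    case (set A)
    then show ?case
      using assms(1) by (simp add: emeasure_mixture)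
  next
    case (mult u k)
    note [measurable] = \<open>u \<in> borel_measurable \<mu>\<close>
    show ?case
      by (simp add: nn_integral_cmult mult.IH distrib_left mult.left_commute)
  next
    case (add u v)
    note [measurable] = \<open>u \<in> borel_measurable \<mu>\<close> \<open>v \<in> borel_measurable \<mu>\<close>
    show ?case
      by (simp add: nn_integral_add add.IH algebra_simps)
  next
    case (seq U)
    note [measurable] = seq(1)
    have SUP: "(\<integral>\<^sup>+x. (SUP i. U i) x \<partial>M) = (SUP i. \<integral>\<^sup>+x. U i x \<partial>M)" if "sets M = sets \<mu>" for M
    proof -
      have "U i \<in> borel_measurable M" for i
        using seq(1) measurable_cong_sets [OF that refl] by blast
      with \<open>incseq U\<close> show ?thesis
        unfolding SUP_apply by (intro nn_integral_monotone_convergence_SUP)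
    qed
    \<comment> \<open>The supremum of a sum splits into the sum of the suprema because both
      sequences increase.\<close>
    have inc: "incseq (\<lambda>i. d * (\<integral>\<^sup>+x. U i x \<partial>M))" for d M
      using \<open>incseq U\<close>
      by (intro incseq_SucI mult_left_mono nn_integral_mono) (auto simp: incseq_Suc_iff le_fun_def)
    show ?case
      unfolding SUP [OF sets_mixture] SUP [OF refl] SUP [OF assms(1)] seq.IH
      by (subst ennreal_SUP_add [OF inc inc]) (simp add: SUP_mult_left_ennreal)
  qed
qed

text \<open>The nonnegative case is applied to the positive and negative parts of \<open>f\<close>.
  Integrability makes all four integrals finite, so \<open>enn2real\<close>, which sends infinity to
  0, respects the sums and products here.\<close>

lemma integral_mixture:
  fixes f :: "'a \<Rightarrow> real"
  assumes "sets \<nu> = sets \<mu>" "integrable \<mu> f" "integrable \<nu> f" "c \<in> {0..1}"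
  shows "(\<integral>x. f x \<partial>mixture c \<mu> \<nu>) = c * (\<integral>x. f x \<partial>\<mu>) + (1 - c) * (\<integral>x. f x \<partial>\<nu>)"
proof -
  have [measurable]: "f \<in> borel_measurable \<mu>"
    using assms(2) by simp
  then have meas: "f \<in> borel_measurable (mixture c \<mu> \<nu>)"
    by (simp cong: measurable_cong_sets)
  have fin: "(\<integral>\<^sup>+x. ennreal (f x) \<partial>\<mu>) < top" "(\<integral>\<^sup>+x. ennreal (- f x) \<partial>\<mu>) < top"
    "(\<integral>\<^sup>+x. ennreal (f x) \<partial>\<nu>) < top" "(\<integral>\<^sup>+x. ennreal (- f x) \<partial>\<nu>) < top"
    using assms(2,3) by (auto simp: real_integrable_def less_top)
  have nn: "(\<integral>\<^sup>+x. ennreal (g x) \<partial>mixture c \<mu> \<nu>) =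
      ennreal c * (\<integral>\<^sup>+x. ennreal (g x) \<partial>\<mu>) + ennreal (1 - c) * (\<integral>\<^sup>+x. ennreal (g x) \<partial>\<nu>)"
    if "g \<in> borel_measurable \<mu>" for g :: "'a \<Rightarrow> real"
    using assms(1) that by (intro nn_integral_mixture) auto
  have "integrable (mixture c \<mu> \<nu>) f"
    using fin meas by (auto simp: real_integrable_def nn ennreal_mult_eq_top_iff)
  then show ?thesis
    using fin assms
    by (simp add: real_lebesgue_integral_def nn enn2real_plus enn2real_mult ennreal_mult_less_top
        algebra_simps)
qed

text \<open>By compactness \<open>f\<close> is bounded on the interval, and a bounded measurable
  function is integrable for a probability measure.\<close>

lemma integrable_continuous_borel_probs:
  fixes f :: "real \<Rightarrow> real"
  assumes "\<mu> \<in> borel_probs a b" "continuous_on {a..b} f"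
  shows "integrable \<mu> f"
proof -
  interpret prob_space \<mu>
    using assms(1) by (simp add: borel_probs_def)
  have "compact (f ` {a..b})"
    using assms(2) by (intro compact_continuous_image) auto
  then obtain B where "\<forall>x\<in>{a..b}. norm (f x) \<le> B"
    by (force dest: compact_imp_bounded simp: bounded_iff)
  \<comment> \<open>The sigma-algebra of \<open>\<mu>\<close> is the Borel one restricted to [a,b],
    so continuity there is enough for measurability.\<close>
  moreover have "f \<in> borel_measurable \<mu>"
    using assms borel_measurable_continuous_on_restrict [of "{a..b}" f]
    by (simp add: borel_probs_def cong: measurable_cong_sets)
  ultimately show ?thesis
    using space_borel_probs [OF assms(1)] by (intro integrable_const_bound [of _ B]) auto
qed

text \<open>The preimage of an open set is one of the sets that generate the topology.\<close>

lemma continuous_map_weak_topology_integral: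
  fixes f :: "real \<Rightarrow> real"
  assumes "continuous_on {a..b} f"
  shows "continuous_map (weak_topology a b) euclidean (\<lambda>\<mu>. \<integral>x. f x \<partial>\<mu>)"
  unfolding continuous_map_def
proof (intro conjI allI impI)
  fix U :: "real set"
  assume "openin euclidean U"
  then show "openin (weak_topology a b) {\<mu> \<in> topspace (weak_topology a b). (\<integral>x. f x \<partial>\<mu>) \<in> U}"
    using assms unfolding topspace_weak_topology unfolding weak_topology_def
    by (intro topology_generated_by_Basis) auto
qed auto

text \<open>On the space [a,b] one has 0 <= b - x <= b - a; take powers and integrate against total
  mass 1.\<close>

lemma eps_bounds:
  assumes "\<mu> \<in> borel_probs a b"
  shows "eps b n \<mu> \<in> {0..(b - a) ^ n / fact n}"
proof -
  interpret prob_space \<mu>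
    using assms by (simp add: borel_probs_def)
  have sp: "space \<mu> = {a..b}"
    using assms by (rule space_borel_probs)
  have "0 \<le> (\<integral>x. (b - x) ^ n \<partial>\<mu>)"
    using sp by (intro integral_nonneg_AE AE_I2) auto
  moreover have "integrable \<mu> (\<lambda>x. (b - x) ^ n)"
    using assms by (rule integrable_continuous_borel_probs) (intro continuous_intros)
  then have "(\<integral>x. (b - x) ^ n \<partial>\<mu>) \<le> (b - a) ^ n"
    using sp by (intro integral_le_const AE_I2) (auto intro!: power_mono)
  ultimately show ?thesis
    by (simp add: eps_def divide_right_mono)
qed

theorem lemma1:
  fixes a b :: real
  assumes "a < b"
  shows "(\<forall>\<mu>1 \<in> borel_probs a b. \<forall>\<mu>2 \<in> borel_probs a b. \<forall>c \<in> {0..1}.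
            primitive_seq b (mixture c \<mu>1 \<mu>2) =
              (\<lambda>n. c * primitive_seq b \<mu>1 n + (1 - c) * primitive_seq b \<mu>2 n))
       \<and> continuous_map (weak_topology a b)
            (product_topology (\<lambda>n::nat. top_of_set {0..(b - a) ^ n / fact n}) UNIV)
            (primitive_seq b)
       \<and> (\<forall>\<mu>s \<mu>. (\<forall>k. \<mu>s k \<in> borel_probs a b) \<longrightarrow> \<mu> \<in> borel_probs a b \<longrightarrow>
            weakly_converges a b \<mu>s \<mu> \<longrightarrow>
            (\<forall>n. (\<lambda>k. eps b n (\<mu>s k)) \<longlonglongrightarrow> eps b n \<mu>))"
proof (intro conjI ballI allI impI)
  have cont: "continuous_on {a..b} (\<lambda>x. (b - x) ^ n)" for n
    by (intro continuous_intros)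
  show "primitive_seq b (mixture c \<mu>1 \<mu>2) =
      (\<lambda>n. c * primitive_seq b \<mu>1 n + (1 - c) * primitive_seq b \<mu>2 n)"
    if "\<mu>1 \<in> borel_probs a b" "\<mu>2 \<in> borel_probs a b" "c \<in> {0..1}" for \<mu>1 \<mu>2 c
  proof -
    have "sets \<mu>2 = sets \<mu>1"
      using that by (simp add: borel_probs_def)
    then have "(\<integral>x. (b - x) ^ n \<partial>mixture c \<mu>1 \<mu>2) =
        c * (\<integral>x. (b - x) ^ n \<partial>\<mu>1) + (1 - c) * (\<integral>x. (b - x) ^ n \<partial>\<mu>2)" for n
      using that cont by (intro integral_mixture integrable_continuous_borel_probs)
    then show ?thesis
      by (simp add: primitive_seq_def eps_def fun_eq_iff add_divide_distrib)
  qed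
  show "continuous_map (weak_topology a b)
      (product_topology (\<lambda>n::nat. top_of_set {0..(b - a) ^ n / fact n}) UNIV) (primitive_seq b)"
    unfolding continuous_map_componentwise_UNIV
  proof
    fix n
    have "continuous_map (weak_topology a b) euclidean (eps b n)"
      unfolding eps_def
      by (intro continuous_map_real_mult continuous_map_weak_topology_integral cont) simp
    then show "continuous_map (weak_topology a b) (top_of_set {0..(b - a) ^ n / fact n})
        (\<lambda>\<mu>. primitive_seq b \<mu> n)"
      \<comment> \<open>Continuity into the subspace is continuity into the real line plus values in
        the interval.\<close>
      using eps_bounds by (auto simp: primitive_seq_def continuous_map_in_subtopology)
  qed
  \<comment> \<open>Sequential convergence needs no detour through the topology: (b - x)^n is itself
    a test function in the definition of weak convergence.\<close>
  show "(\<lambda>k. eps b n (\<mu>s k)) \<longlonglongrightarrow> eps b n \<mu>" if "weakly_converges a b \<mu>s \<mu>" for \<mu>s \<mu> n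
    using that cont unfolding eps_def weakly_converges_def by (intro tendsto_mult_left) blast
qed

end
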